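(* Let $s\in(1,\infty)$. For every $\bar u\in L^s(\Omega)$, \[ \widehat{\partial} q_{s,0}(\bar u)=\begin{cases}\{\eta\in L^r(\Omega) : \{\eta\neq 0\}\subset\{\bar u=0\}\} & \text{if } \bar u \text{ is an } s\text{-SD function},\\ \varnothing & \text{otherwise.}\end{cases} \]
   Context: $\Omega\subset\mathbb{R}^d$ is a Lebesgue-measurable set with positive and finite Lebesgue measure; $\boldsymbol{\lambda}$ denotes Lebesgue measure. For $s\in(1,\infty)$, $r\in(1,\infty)$ is given by $\frac1s+\frac1r=1$, and $L^r(\Omega)$ is identified with the dual of $L^s(\Omega)$. For measurable $u$, $\{u\neq0\}:=\{x\in\Omega : u(x)\neq 0\}$ and $\{u=0\}:=\{x\in\Omega : u(x)=0\}$; these sets are defined up to null sets and inclusions between them are understood up to null sets. For measurable $\Omega'\subset\Omega$, $\Vert u\Vert_{s,\Omega'}:=\bigl(\int_{\Omega'}|u(x)|^s\,\mathrm{d}x\bigr)^{1/s}$. The functional $q_{s,0}\colon L^s(\Omega)\to\mathbb{R}$ is $q_{s,0}(u):=\int_\Omega |u(x)|_0\,\mathrm{d}x=\boldsymbol{\lambda}(\{u\neq 0\})$, where $|y|_0:=0$ if $y=0$ and $|y|_0:=1$ for $y\in\mathbb{R}\setminus\{0\}$. The Fréchet subdifferential of $q_{s,0}$ at $\bar u\in L^s(\Omega)$ is \[ \widehat{\partial} q_{s,0}(\bar u):=\Bigl\{\eta\in L^r(\Omega) : \liminf_{\Vert h\Vert_s\searrow 0}\frac{q_{s,0}(\bar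 u+h)-q_{s,0}(\bar u)-\int_\Omega\eta(x)h(x)\,\mathrm{d}x}{\Vert h\Vert_s}\ge 0\Bigr\}, \] where the lower limit is over $h\in L^s(\Omega)\setminus\{0\}$ with $\Vert h\Vert_s\to 0$. A function $\bar u\in L^s(\Omega)$ is called order $s$ slowly decreasing (an $s$-SD function) if for each sequence $\{\Omega_k\}_{k\in\mathbb{N}}$ of measurable subsets of $\{\bar u\neq 0\}$ with $\boldsymbol{\lambda}(\Omega_k)>0$ for all $k$ and $\boldsymbol{\lambda}(\Omega_k)\to 0$, one has $\boldsymbol{\lambda}(\Omega_k)/\Vert\bar u\Vert_{s,\Omega_k}\to 0$. (In particular the zero function is $s$-SD.) *)

theory Defs
  imports "HOL-Analysis.Analysis"
begin

text \<open>
  The elements of \<open>L\<^sup>p(\<Omega>)\<close> are represented by functions on the whole space, whose values outside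
  \<open>\<Omega>\<close> are irrelevant; functions agreeing almost everywhere on \<open>\<Omega>\<close> are not identified. Every set of
  functions and every property of functions below is invariant under changes on a null set
  and outside \<open>\<Omega>\<close>, so equality of two such sets is equality of the corresponding sets of classes.
\<close>

definition Lp :: "real \<Rightarrow> (real ^ 'd) set \<Rightarrow> (real ^ 'd \<Rightarrow> real) set" where
  "Lp p \<Omega> = {u. u \<in> borel_measurable (lebesgue_on \<Omega>) \<and>
                integrable (lebesgue_on \<Omega>) (\<lambda>x. \<bar>u x\<bar> powr p)}"

definition Lp_norm :: "real \<Rightarrow> (real ^ 'd) set \<Rightarrow> (real ^ 'd \<Rightarrow> real) \<Rightarrow> real" where
  "Lp_norm p A u = (LINT x|lebesgue_on A. \<bar>u x\<bar> powr p) powr (1 / p)"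

definition ae_subset :: "(real ^ 'd) set \<Rightarrow> (real ^ 'd) set \<Rightarrow> (real ^ 'd) set \<Rightarrow> bool" where
  "ae_subset \<Omega> A B \<longleftrightarrow> (AE x in lebesgue_on \<Omega>. x \<in> A \<longrightarrow> x \<in> B)"

definition abs0 :: "real \<Rightarrow> real" where
  "abs0 y = (if y = 0 then 0 else 1)"

definition q0 :: "(real ^ 'd) set \<Rightarrow> (real ^ 'd \<Rightarrow> real) \<Rightarrow> real" where
  "q0 \<Omega> u = (LINT x|lebesgue_on \<Omega>. abs0 (u x))"

text \<open>
  The filter of \<open>h \<in> L\<^sup>s(\<Omega>)\<close> with \<open>\<parallel>h\<parallel>\<^sub>s \<searrow> 0\<close>. Since \<^term>\<open>at_right 0\<close> only sees positive
  norms, functions vanishing almost everywhere are excluded.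
\<close>

definition Lp_at_zero :: "real \<Rightarrow> (real ^ 'd) set \<Rightarrow> (real ^ 'd \<Rightarrow> real) filter" where
  "Lp_at_zero s \<Omega> = inf (principal (Lp s \<Omega>)) (filtercomap (Lp_norm s \<Omega>) (at_right 0))"

text \<open>
  The Frechet subdifferential of a functional \<open>f\<close> on \<open>L\<^sup>s(\<Omega>)\<close>, where \<open>r\<close> is the exponent
  conjugate to \<open>s\<close> and \<open>L\<^sup>r(\<Omega>)\<close> stands for the dual of \<open>L\<^sup>s(\<Omega>)\<close>.
\<close>

definition frechet_subdifferential ::
    "(real ^ 'd) set \<Rightarrow> real \<Rightarrow> real \<Rightarrow> ((real ^ 'd \<Rightarrow> real) \<Rightarrow> real) \<Rightarrow>
     (real ^ 'd \<Rightarrow> real) \<Rightarrow> (real ^ 'd \<Rightarrow> real) set" where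
  "frechet_subdifferential \<Omega> s r f u =
     {\<eta> \<in> Lp r \<Omega>.
        Liminf (Lp_at_zero s \<Omega>)
          (\<lambda>h. ereal ((f (\<lambda>x. u x + h x) - f u - (LINT x|lebesgue_on \<Omega>. \<eta> x * h x))
                       / Lp_norm s \<Omega> h)) \<ge> 0}"

definition slowly_decreasing :: "real \<Rightarrow> (real ^ 'd) set \<Rightarrow> (real ^ 'd \<Rightarrow> real) \<Rightarrow> bool" where
  "slowly_decreasing s \<Omega> u \<longleftrightarrow>
     (\<forall>A :: nat \<Rightarrow> (real ^ 'd) set.
        (\<forall>k. A k \<in> sets (lebesgue_on \<Omega>) \<and> ae_subset \<Omega> (A k) {x \<in> \<Omega>. u x \<noteq> 0}
             \<and> measure lebesgue (A k) > 0)
        \<and> (\<lambda>k. measure lebesgue (A k)) \<longlonglongrightarrow> 0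
        \<longrightarrow> (\<lambda>k. measure lebesgue (A k) / Lp_norm s (A k) u) \<longlonglongrightarrow> 0)"

end

theory Submission imports Defs begin

text \<open>
  The increment \<open>q(u + h) - q(u)\<close> is the measure of \<open>B = {u = 0, h \<noteq> 0}\<close> minus that of
  \<open>A = {u \<noteq> 0, u + h = 0}\<close>. On \<open>A\<close> we have \<open>h = -u\<close>, so \<open>\<parallel>u\<parallel>\<close> over \<open>A\<close> is at most \<open>\<parallel>h\<parallel>\<close>; hence \<open>A\<close> is small
  when \<open>h\<close> is, and slow decrease makes the measure of \<open>A\<close> negligible against \<open>\<parallel>h\<parallel>\<close>. If \<open>\<eta>\<close> lives on
  \<open>{u = 0}\<close>, Hoelder's inequality bounds \<open>\<integral>\<eta>h\<close> by \<open>\<parallel>\<eta>\<parallel>\<parallel>h\<parallel>\<close> over \<open>B\<close>, which is negligible against \<open>\<parallel>h\<parallel>\<close>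
  if \<open>B\<close> is small and is dominated by the measure of \<open>B\<close> otherwise. Conversely, for a subgradient
  \<open>\<eta>\<close>, the directions \<open>-u 1\<^bsub>A\<^esub>\<close> with \<open>A \<subseteq> {u \<noteq> 0}\<close> yield slow decrease, and the directions
  \<open>t sgn(\<eta>) 1\<^bsub>D\<^esub>\<close> with \<open>D = {|u| > \<gamma>, \<eta> \<noteq> 0}\<close>, which do not change \<open>q\<close> for \<open>t < \<gamma>\<close>, yield \<open>\<eta> = 0\<close> on
  \<open>{u \<noteq> 0}\<close>.
\<close>

subsection \<open>Integrals over small sets\<close>

text \<open>Young's inequality applied pointwise to \<open>f\<close> and \<open>g\<close> gives
  integrability of the product. Applied to the normalised functions \<open>f / a\<close> and
  \<open>g / b\<close>, it integrates to \<open>1 / p + 1 / q = 1\<close>, which is the bound after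
  rescaling.\<close>

lemma Holder_integral:
  fixes f g :: "'a \<Rightarrow> real" and p q :: real
  assumes pq: "1 < p" "1 < q" "1 / p + 1 / q = 1"
    and [measurable]: "f \<in> borel_measurable M" "g \<in> borel_measurable M"
    and fi: "integrable M (\<lambda>x. \<bar>f x\<bar> powr p)" and gi: "integrable M (\<lambda>x. \<bar>g x\<bar> powr q)"
  shows Holder_integrable: "integrable M (\<lambda>x. f x * g x)"
    and Holder_integral_le: "\<bar>LINT x|M. f x * g x\<bar>
      \<le> (LINT x|M. \<bar>f x\<bar> powr p) powr (1 / p) * (LINT x|M. \<bar>g x\<bar> powr q) powr (1 / q)"
proof -
  show int: "integrable M (\<lambda>x. f x * g x)"
  proof (rule Bochner_Integration.integrable_bound)
    show "integrable M (\<lambda>x. \<bar>f x\<bar> powr p / p + \<bar>g x\<bar> powr q / q)"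
      using fi gi by auto
    show "AE x in M. norm (f x * g x) \<le> norm (\<bar>f x\<bar> powr p / p + \<bar>g x\<bar> powr q / q)"
    proof (intro AE_I2)
      fix x
      have "\<bar>f x\<bar> * \<bar>g x\<bar> \<le> \<bar>f x\<bar> powr p / p + \<bar>g x\<bar> powr q / q"
        by (rule Youngs_inequality) (use pq in auto)
      then show "norm (f x * g x) \<le> norm (\<bar>f x\<bar> powr p / p + \<bar>g x\<bar> powr q / q)"
        by (simp add: abs_mult)
    qed
  qed measurable
  define I where "I = (LINT x|M. \<bar>f x\<bar> powr p)"
  define J where "J = (LINT x|M. \<bar>g x\<bar> powr q)"
  \<comment> \<open>The normalisation divides by \<open>I\<close> and \<open>J\<close>, so the
    degenerate case is settled first: one factor then vanishes almost everywhere.\<close>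
  have zero: "(LINT x|M. f x * g x) = 0" if "I = 0 \<or> J = 0"
  proof -
    have "AE x in M. f x * g x = 0"
      using that
    proof
      assume "I = 0"
      then have "AE x in M. \<bar>f x\<bar> powr p = 0"
        unfolding I_def using fi by (subst (asm) integral_nonneg_eq_0_iff_AE) auto
      then show ?thesis by eventually_elim simp
    next
      assume "J = 0"
      then have "AE x in M. \<bar>g x\<bar> powr q = 0"
        unfolding J_def using gi by (subst (asm) integral_nonneg_eq_0_iff_AE) auto
      then show ?thesis by eventually_elim simp
    qed
    then show ?thesis by (rule integral_eq_zero_AE)
  qed
  have "\<bar>LINT x|M. f x * g x\<bar> \<le> I powr (1 / p) * J powr (1 / q)"
  proof (cases "I = 0 \<or> J = 0")
    case True
    then show ?thesis using zero by simp
  next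
    case False
    then have pos: "I > 0" "J > 0"
      unfolding I_def J_def by (simp_all add: order.strict_iff_order Bochner_Integration.integral_nonneg)
    define a where "a = I powr (1 / p)"
    define b where "b = J powr (1 / q)"
    have ab: "a > 0" "b > 0" "a powr p = I" "b powr q = J"
      using pos pq by (auto simp: a_def b_def powr_powr)
    have "\<bar>LINT x|M. f x * g x\<bar> / (a * b) = \<bar>LINT x|M. f x * g x / (a * b)\<bar>"
      using ab by (simp add: abs_mult)
    also have "\<dots> \<le> (LINT x|M. \<bar>f x * g x / (a * b)\<bar>)"
      by (rule integral_abs_bound)
    also have "\<dots> \<le> (LINT x|M. \<bar>f x\<bar> powr p / (I * p) + \<bar>g x\<bar> powr q / (J * q))"
    proof (rule integral_mono)
      show "integrable M (\<lambda>x. \<bar>f x * g x / (a * b)\<bar>)" using int by auto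
      show "integrable M (\<lambda>x. \<bar>f x\<bar> powr p / (I * p) + \<bar>g x\<bar> powr q / (J * q))"
        using fi gi by auto
      fix x
      have "(\<bar>f x\<bar> / a) * (\<bar>g x\<bar> / b) \<le> (\<bar>f x\<bar> / a) powr p / p + (\<bar>g x\<bar> / b) powr q / q"
        by (rule Youngs_inequality) (use pq ab in auto)
      then show "\<bar>f x * g x / (a * b)\<bar> \<le> \<bar>f x\<bar> powr p / (I * p) + \<bar>g x\<bar> powr q / (J * q)"
        using ab by (simp add: abs_mult powr_divide)
    qed
    also have "\<dots> = I / (I * p) + J / (J * q)"
      using fi gi by (simp add: I_def J_def)
    also have "\<dots> = 1" using pos pq by simp
    finally show ?thesis using ab by (simp add: a_def b_def divide_le_eq)
  qed
  then show "\<bar>LINT x|M. f x * g x\<bar>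
      \<le> (LINT x|M. \<bar>f x\<bar> powr p) powr (1 / p) * (LINT x|M. \<bar>g x\<bar> powr q) powr (1 / q)"
    by (simp add: I_def J_def)
qed

text \<open>Absolute continuity of the integral, by truncation: the part of \<open>f\<close> above
  level \<open>n\<close> has small integral by dominated convergence, and the rest contributes at
  most \<open>n\<close> times the measure of the set.\<close>

lemma (in finite_measure) integral_small_on_small_sets:
  fixes f :: "'a \<Rightarrow> real"
  assumes f: "integrable M f" and "\<epsilon> > 0"
  obtains \<delta> where "\<delta> > 0"
    and "\<And>A. A \<in> sets M \<Longrightarrow> measure M A < \<delta> \<Longrightarrow> (LINT x|M. indicator A x * \<bar>f x\<bar>) < \<epsilon>"
proof -
  have [measurable]: "f \<in> borel_measurable M" using f by auto
  define T where "T n = {x \<in> space M. \<bar>f x\<bar> > real n}" for n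
  have [measurable]: "T n \<in> sets M" for n unfolding T_def by measurable
  have "(\<lambda>n. LINT x|M. indicator (T n) x * \<bar>f x\<bar>) \<longlonglongrightarrow> (LINT x|M. 0)"
  proof (rule integral_dominated_convergence)
    show "integrable M (\<lambda>x. \<bar>f x\<bar>)" using f by auto
    show "AE x in M. (\<lambda>n. indicator (T n) x * \<bar>f x\<bar>) \<longlonglongrightarrow> 0"
    proof (intro AE_I2)
      fix x
      obtain n where n: "\<bar>f x\<bar> \<le> real n" using real_arch_simple by blast
      have "\<forall>\<^sub>F m in sequentially. indicator (T m) x * \<bar>f x\<bar> = 0"
        using eventually_ge_at_top[of n]
        by eventually_elim (use n in \<open>auto simp: T_def indicator_def\<close>)
      then show "(\<lambda>n. indicator (T n) x * \<bar>f x\<bar>) \<longlonglongrightarrow> 0"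
        by (rule tendsto_eventually)
    qed
  qed (auto simp: indicator_def)
  then have "\<forall>\<^sub>F n in sequentially. (LINT x|M. indicator (T n) x * \<bar>f x\<bar>) < \<epsilon> / 2"
    using \<open>\<epsilon> > 0\<close> by (auto dest: order_tendstoD(2)[where a = "\<epsilon> / 2"])
  then obtain n where n: "(LINT x|M. indicator (T n) x * \<bar>f x\<bar>) < \<epsilon> / 2"
    by (auto simp: eventually_sequentially)
  show ?thesis
  proof
    \<comment> \<open>The summand \<open>1\<close> keeps the threshold meaningful when the
      truncation level is \<open>n = 0\<close>.\<close>
    show "\<epsilon> / (2 * (real n + 1)) > 0" using \<open>\<epsilon> > 0\<close> by simp
    fix A assume [measurable]: "A \<in> sets M" and A: "measure M A < \<epsilon> / (2 * (real n + 1))"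
    have i: "integrable M (\<lambda>x. indicator B x * \<bar>f x\<bar>)" if "B \<in> sets M" for B
      using integrable_mult_indicator[OF that, of "\<lambda>x. \<bar>f x\<bar>"] f by simp
    have j: "integrable M (\<lambda>x. real n * indicator A x)"
      by (simp add: integrable_real_indicator less_top[symmetric])
    have "(LINT x|M. indicator A x * \<bar>f x\<bar>)
        \<le> (LINT x|M. real n * indicator A x + indicator (T n) x * \<bar>f x\<bar>)"
    proof (rule integral_mono)
      show "integrable M (\<lambda>x. indicator A x * \<bar>f x\<bar>)" by (rule i) measurable
      show "integrable M (\<lambda>x. real n * indicator A x + indicator (T n) x * \<bar>f x\<bar>)"
        by (intro Bochner_Integration.integrable_add i j) measurable
    qed (auto simp: indicator_def T_def)
    also have "\<dots> = real n * measure M A + (LINT x|M. indicator (T n) x * \<bar>f x\<bar>)"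
      using i j by simp
    also have "\<dots> < \<epsilon> / 2 + \<epsilon> / 2"
    proof (rule add_le_less_mono[OF _ n])
      have "real n * measure M A \<le> (real n + 1) * measure M A" by (intro mult_right_mono) auto
      also have "\<dots> \<le> \<epsilon> / 2" using A by (simp add: field_simps)
      finally show "real n * measure M A \<le> \<epsilon> / 2" .
    qed
    finally show "(LINT x|M. indicator A x * \<bar>f x\<bar>) < \<epsilon>" by simp
  qed
qed

text \<open>The sets where \<open>f\<close> is nonzero but small decrease to the empty set, so one
  of them has measure below \<open>\<delta> / 2\<close>. At least half of the required measure of
  \<open>A\<close> then lies where \<open>f\<close> exceeds a fixed positive level in absolute
  value.\<close>

lemma (in finite_measure) integral_bounded_below_on_large_sets:
  fixes f :: "'a \<Rightarrow> real"
  assumes f: "integrable M f" and "\<delta> > 0"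
  obtains c where "c > 0"
    and "\<And>A. A \<in> sets M \<Longrightarrow> (AE x in M. x \<in> A \<longrightarrow> f x \<noteq> 0) \<Longrightarrow> \<delta> \<le> measure M A
      \<Longrightarrow> c \<le> (LINT x|M. indicator A x * \<bar>f x\<bar>)"
proof -
  have [measurable]: "f \<in> borel_measurable M" using f by auto
  define B where "B n = {x \<in> space M. 0 < \<bar>f x\<bar> \<and> \<bar>f x\<bar> \<le> inverse (real (Suc n))}" for n
  have [measurable]: "B n \<in> sets M" for n unfolding B_def by measurable
  have "decseq B"
  proof (rule decseq_SucI)
    fix n
    have "inverse (real (Suc (Suc n))) \<le> inverse (real (Suc n))" by (simp add: field_simps)
    then show "B (Suc n) \<subseteq> B n" unfolding B_def by (blast intro: order_trans)
  qed
  have "(\<Inter>n. B n) = {}"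
  proof (rule ccontr)
    assume "(\<Inter>n. B n) \<noteq> {}"
    then obtain x where x: "\<And>n. x \<in> B n" by auto
    then have "0 < \<bar>f x\<bar>" by (auto simp: B_def)
    then obtain n where "inverse (real (Suc n)) < \<bar>f x\<bar>" using reals_Archimedean by blast
    with x[of n] show False by (auto simp: B_def)
  qed
  with finite_Lim_measure_decseq[OF _ \<open>decseq B\<close>] have "(\<lambda>n. measure M (B n)) \<longlonglongrightarrow> 0"
    by (simp add: image_subset_iff)
  then have "\<forall>\<^sub>F n in sequentially. measure M (B n) < \<delta> / 2"
    using \<open>\<delta> > 0\<close> by (auto dest: order_tendstoD(2)[where a = "\<delta> / 2"])
  then obtain n where n: "measure M (B n) < \<delta> / 2" by (auto simp: eventually_sequentially)
  define \<gamma> where "\<gamma> = inverse (real (Suc n))"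
  have "\<gamma> > 0" by (simp add: \<gamma>_def)
  show ?thesis
  proof
    show "\<gamma> * (\<delta> / 2) > 0" using \<open>\<delta> > 0\<close> \<open>\<gamma> > 0\<close> by simp
    fix A assume [measurable]: "A \<in> sets M" and nz: "AE x in M. x \<in> A \<longrightarrow> f x \<noteq> 0"
      and A: "\<delta> \<le> measure M A"
    have "measure M A \<le> measure M ((A - B n) \<union> B n)"
      by (intro finite_measure_mono) auto
    also have "\<dots> \<le> measure M (A - B n) + measure M (B n)"
      by (intro measure_subadditive) auto
    finally have "\<delta> / 2 \<le> measure M (A - B n)" using A n by simp
    then have "\<gamma> * (\<delta> / 2) \<le> \<gamma> * measure M (A - B n)" using \<open>\<gamma> > 0\<close> by simp
    also have "\<dots> = (LINT x|M. \<gamma> * indicator (A - B n) x)" by simp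
    also have "\<dots> \<le> (LINT x|M. indicator A x * \<bar>f x\<bar>)"
    proof (rule integral_mono_AE)
      show "integrable M (\<lambda>x. \<gamma> * indicator (A - B n) x)"
        by (simp add: integrable_real_indicator less_top[symmetric])
      show "integrable M (\<lambda>x. indicator A x * \<bar>f x\<bar>)"
        using integrable_mult_indicator[of A M "\<lambda>x. \<bar>f x\<bar>"] f by simp
      show "AE x in M. \<gamma> * indicator (A - B n) x \<le> indicator A x * \<bar>f x\<bar>"
        using nz AE_space
        by eventually_elim (use \<open>\<gamma> > 0\<close> in \<open>auto simp: indicator_def B_def \<gamma>_def\<close>)
    qed
    finally show "\<gamma> * (\<delta> / 2) \<le> (LINT x|M. indicator A x * \<bar>f x\<bar>)" .
  qed
qed

subsection \<open>The norm over subsets\<close>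

lemma Lp_norm_nonneg: "0 \<le> Lp_norm p A f"
  by (simp add: Lp_norm_def)

lemma Lp_norm_cong:
  assumes "\<And>x. x \<in> A \<Longrightarrow> \<bar>f x\<bar> = \<bar>g x\<bar>"
  shows "Lp_norm p A f = Lp_norm p A g"
proof -
  have "(LINT x|lebesgue_on A. \<bar>f x\<bar> powr p) = (LINT x|lebesgue_on A. \<bar>g x\<bar> powr p)"
    using assms by (intro Bochner_Integration.integral_cong) simp_all
  then show ?thesis by (simp add: Lp_norm_def)
qed

text \<open>Rewrites norms over varying subsets as weighted integrals over the one finite measure
  space \<open>lebesgue_on \<Omega>\<close>, where the integral estimates above apply.\<close>

lemma Lp_norm_subset_eq:
  assumes \<Omega>: "\<Omega> \<in> sets lebesgue" and A: "A \<in> sets (lebesgue_on \<Omega>)"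
  shows "Lp_norm p A f = (LINT x|lebesgue_on \<Omega>. indicator A x * \<bar>f x\<bar> powr p) powr (1 / p)"
proof -
  have A': "A \<in> sets lebesgue" "A \<subseteq> \<Omega>" using A \<Omega> by (auto simp: sets_restrict_space_iff)
  have "(LINT x|lebesgue_on A. \<bar>f x\<bar> powr p) = (LINT x|lebesgue. indicator A x *\<^sub>R (\<bar>f x\<bar> powr p))"
    using A' by (intro integral_restrict_space) auto
  also have "\<dots> = (LINT x|lebesgue. indicator \<Omega> x *\<^sub>R (indicator A x * \<bar>f x\<bar> powr p))"
    using A' by (intro Bochner_Integration.integral_cong) (auto simp: indicator_def)
  also have "\<dots> = (LINT x|lebesgue_on \<Omega>. indicator A x * \<bar>f x\<bar> powr p)"
    using \<Omega> by (intro integral_restrict_space[symmetric]) auto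
  finally show ?thesis by (simp add: Lp_norm_def)
qed

lemma Lp_norm_indicator:
  assumes "\<Omega> \<in> sets lebesgue" and "A \<in> sets (lebesgue_on \<Omega>)"
  shows "Lp_norm p \<Omega> (\<lambda>x. indicator A x * f x) = Lp_norm p A f"
proof -
  have "(LINT x|lebesgue_on \<Omega>. \<bar>indicator A x * f x\<bar> powr p)
      = (LINT x|lebesgue_on \<Omega>. indicator A x * \<bar>f x\<bar> powr p)"
    by (intro Bochner_Integration.integral_cong) (auto simp: indicator_def)
  then show ?thesis using Lp_norm_subset_eq[OF assms] by (simp add: Lp_norm_def)
qed

lemma Lp_indicator:
  assumes "A \<in> sets (lebesgue_on \<Omega>)" and "f \<in> Lp p \<Omega>"
  shows "(\<lambda>x. indicator A x * f x) \<in> Lp p \<Omega>"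
proof -
  have "integrable (lebesgue_on \<Omega>) (\<lambda>x. indicator A x *\<^sub>R (\<bar>f x\<bar> powr p))"
    using assms by (intro integrable_mult_indicator) (auto simp: Lp_def)
  also have "(\<lambda>x. indicator A x *\<^sub>R (\<bar>f x\<bar> powr p)) = (\<lambda>x. \<bar>indicator A x * f x\<bar> powr p)"
    by (auto simp: indicator_def)
  finally show ?thesis using assms by (auto simp: Lp_def)
qed

lemma Lp_uminus:
  assumes "f \<in> Lp p \<Omega>"
  shows "(\<lambda>x. - f x) \<in> Lp p \<Omega>"
  using assms by (simp add: Lp_def)

lemma Lp_norm_subset_mono:
  assumes "\<Omega> \<in> sets lebesgue" and A: "A \<in> sets (lebesgue_on \<Omega>)" and f: "f \<in> Lp p \<Omega>" and "1 < p"
  shows "Lp_norm p A f \<le> Lp_norm p \<Omega> f"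
proof -
  have "(LINT x|lebesgue_on \<Omega>. indicator A x * \<bar>f x\<bar> powr p) \<le> (LINT x|lebesgue_on \<Omega>. \<bar>f x\<bar> powr p)"
    using f integrable_mult_indicator[OF A, of "\<lambda>x. \<bar>f x\<bar> powr p"]
    by (intro integral_mono) (auto simp: Lp_def indicator_def)
  then show ?thesis
    unfolding Lp_norm_subset_eq[OF assms(1) A] unfolding Lp_norm_def
    using \<open>1 < p\<close> by (intro powr_mono2) (auto intro!: Bochner_Integration.integral_nonneg)
qed

text \<open>Cutting off both factors is harmless because an indicator is idempotent, and it
  localises both norms to \<open>A\<close>.\<close>

lemma Holder_Lp:
  assumes "\<Omega> \<in> sets lebesgue" and A: "A \<in> sets (lebesgue_on \<Omega>)"
    and "1 < s" "1 < r" "1 / s + 1 / r = 1" and f: "f \<in> Lp r \<Omega>" and g: "g \<in> Lp s \<Omega>"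
  shows "\<bar>LINT x|lebesgue_on \<Omega>. indicator A x * (f x * g x)\<bar> \<le> Lp_norm r A f * Lp_norm s A g"
proof -
  let ?f = "\<lambda>x. indicator A x * f x" and ?g = "\<lambda>x. indicator A x * g x"
  have "\<bar>LINT x|lebesgue_on \<Omega>. ?f x * ?g x\<bar> \<le> Lp_norm r \<Omega> ?f * Lp_norm s \<Omega> ?g"
    unfolding Lp_norm_def
    using Lp_indicator[OF A f] Lp_indicator[OF A g] assms(3-5)
    by (intro Holder_integral_le) (auto simp: Lp_def)
  also have "(\<lambda>x. ?f x * ?g x) = (\<lambda>x. indicator A x * (f x * g x))"
    by (auto simp: indicator_def)
  finally show ?thesis by (simp add: Lp_norm_indicator[OF assms(1) A])
qed

lemma Lp_norm_small_on_small_sets: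
  assumes \<Omega>: "\<Omega> \<in> lmeasurable" and f: "f \<in> Lp p \<Omega>" and "1 < p" and "\<epsilon> > 0"
  obtains \<delta> where "\<delta> > 0"
    and "\<And>A. A \<in> sets (lebesgue_on \<Omega>) \<Longrightarrow> measure (lebesgue_on \<Omega>) A < \<delta> \<Longrightarrow> Lp_norm p A f < \<epsilon>"
proof -
  interpret finite_measure "lebesgue_on \<Omega>" using \<Omega> by (rule finite_measure_lebesgue_on)
  have "\<epsilon> powr p > 0" using \<open>\<epsilon> > 0\<close> by simp
  moreover have "integrable (lebesgue_on \<Omega>) (\<lambda>x. \<bar>f x\<bar> powr p)" using f by (simp add: Lp_def)
  ultimately obtain \<delta> where \<delta>: "\<delta> > 0"
    "\<And>A. A \<in> sets (lebesgue_on \<Omega>) \<Longrightarrow> measure (lebesgue_on \<Omega>) A < \<delta>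
      \<Longrightarrow> (LINT x|lebesgue_on \<Omega>. indicator A x * \<bar>\<bar>f x\<bar> powr p\<bar>) < \<epsilon> powr p"
    using integral_small_on_small_sets by blast
  show ?thesis
  proof
    fix A assume A: "A \<in> sets (lebesgue_on \<Omega>)" "measure (lebesgue_on \<Omega>) A < \<delta>"
    have "(LINT x|lebesgue_on \<Omega>. indicator A x * \<bar>f x\<bar> powr p) powr (1 / p) < (\<epsilon> powr p) powr (1 / p)"
      using \<delta>(2)[OF A] \<open>1 < p\<close>
      by (intro powr_less_mono2) (auto intro!: Bochner_Integration.integral_nonneg)
    then show "Lp_norm p A f < \<epsilon>"
      using Lp_norm_subset_eq[OF fmeasurableD[OF \<Omega>] A(1)] \<open>1 < p\<close> \<open>\<epsilon> > 0\<close> by (simp add: powr_powr)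
  qed (fact \<delta>(1))
qed

text \<open>Used contrapositively: a subset of the support over which \<open>f\<close> has small
  norm must itself have small measure.\<close>

lemma Lp_norm_bounded_below_on_large_sets:
  assumes \<Omega>: "\<Omega> \<in> lmeasurable" and f: "f \<in> Lp p \<Omega>" and "1 < p" and "\<delta> > 0"
  obtains c where "c > 0"
    and "\<And>A. A \<in> sets (lebesgue_on \<Omega>) \<Longrightarrow> ae_subset \<Omega> A {x \<in> \<Omega>. f x \<noteq> 0}
      \<Longrightarrow> \<delta> \<le> measure (lebesgue_on \<Omega>) A \<Longrightarrow> c \<le> Lp_norm p A f"
proof -
  interpret finite_measure "lebesgue_on \<Omega>" using \<Omega> by (rule finite_measure_lebesgue_on)
  have "integrable (lebesgue_on \<Omega>) (\<lambda>x. \<bar>f x\<bar> powr p)" using f by (simp add: Lp_def)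
  then obtain c where c: "c > 0"
    "\<And>A. A \<in> sets (lebesgue_on \<Omega>) \<Longrightarrow> (AE x in lebesgue_on \<Omega>. x \<in> A \<longrightarrow> \<bar>f x\<bar> powr p \<noteq> 0)
      \<Longrightarrow> \<delta> \<le> measure (lebesgue_on \<Omega>) A
      \<Longrightarrow> c \<le> (LINT x|lebesgue_on \<Omega>. indicator A x * \<bar>\<bar>f x\<bar> powr p\<bar>)"
    using integral_bounded_below_on_large_sets[OF _ \<open>\<delta> > 0\<close>] by blast
  show ?thesis
  proof
    show "c powr (1 / p) > 0" using c(1) by simp
    fix A assume A: "A \<in> sets (lebesgue_on \<Omega>)" "ae_subset \<Omega> A {x \<in> \<Omega>. f x \<noteq> 0}"
      "\<delta> \<le> measure (lebesgue_on \<Omega>) A"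
    have "AE x in lebesgue_on \<Omega>. x \<in> A \<longrightarrow> \<bar>f x\<bar> powr p \<noteq> 0"
      using A(2) unfolding ae_subset_def by eventually_elim auto
    then have "c powr (1 / p) \<le> (LINT x|lebesgue_on \<Omega>. indicator A x * \<bar>f x\<bar> powr p) powr (1 / p)"
      using c(2)[OF A(1) _ A(3)] \<open>1 < p\<close> c(1) by (intro powr_mono2) auto
    then show "c powr (1 / p) \<le> Lp_norm p A f"
      using Lp_norm_subset_eq[OF fmeasurableD[OF \<Omega>] A(1)] by simp
  qed
qed

lemma Lp_norm_pos:
  assumes "\<Omega> \<in> lmeasurable" "f \<in> Lp p \<Omega>" "1 < p"
    and "A \<in> sets (lebesgue_on \<Omega>)" "ae_subset \<Omega> A {x \<in> \<Omega>. f x \<noteq> 0}"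
    and "0 < measure (lebesgue_on \<Omega>) A"
  shows "0 < Lp_norm p A f"
proof -
  obtain c where c: "c > 0"
    "\<And>B. B \<in> sets (lebesgue_on \<Omega>) \<Longrightarrow> ae_subset \<Omega> B {x \<in> \<Omega>. f x \<noteq> 0}
      \<Longrightarrow> measure (lebesgue_on \<Omega>) A \<le> measure (lebesgue_on \<Omega>) B \<Longrightarrow> c \<le> Lp_norm p B f"
    using Lp_norm_bounded_below_on_large_sets[OF assms(1-3,6)] by blast
  \<comment> \<open>The lower bound is used with the measure of \<open>A\<close> itself as the
    threshold.\<close>
  show ?thesis using c(1) c(2)[OF assms(4,5) order.refl] by (rule order.strict_trans2)
qed

subsection \<open>The subdifferential\<close>

lemma measure_lebesgue_on_eq:
  assumes "\<Omega> \<in> sets lebesgue" and "A \<in> sets (lebesgue_on \<Omega>)"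
  shows "measure (lebesgue_on \<Omega>) A = measure lebesgue A"
  using assms by (intro measure_restrict_space) (auto simp: sets_restrict_space_iff)

lemma eventually_Lp_at_zero:
  "eventually P (Lp_at_zero s \<Omega>)
    \<longleftrightarrow> (\<exists>\<delta>>0. \<forall>h\<in>Lp s \<Omega>. 0 < Lp_norm s \<Omega> h \<and> Lp_norm s \<Omega> h < \<delta> \<longrightarrow> P h)"
    (is "?lhs \<longleftrightarrow> ?rhs")
proof -
  have "?lhs \<longleftrightarrow> (\<exists>Q. (\<exists>\<delta>>0. \<forall>y>0. y < \<delta> \<longrightarrow> Q y) \<and> (\<forall>h. Q (Lp_norm s \<Omega> h) \<longrightarrow> h \<in> Lp s \<Omega> \<longrightarrow> P h))"
    unfolding Lp_at_zero_def inf_commute[of "principal _"] eventually_inf_principal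
      eventually_filtercomap eventually_at_right_field ..
  also have "\<dots> \<longleftrightarrow> ?rhs"
  proof
    assume ?rhs
    then obtain \<delta> where "\<delta> > 0"
      "\<forall>h\<in>Lp s \<Omega>. 0 < Lp_norm s \<Omega> h \<and> Lp_norm s \<Omega> h < \<delta> \<longrightarrow> P h"
      by blast
    then show "\<exists>Q. (\<exists>\<delta>>0. \<forall>y>0. y < \<delta> \<longrightarrow> Q y) \<and> (\<forall>h. Q (Lp_norm s \<Omega> h) \<longrightarrow> h \<in> Lp s \<Omega> \<longrightarrow> P h)"
      \<comment> \<open>The largest predicate on norms needed is membership in the open interval
        from \<open>0\<close> to \<open>\<delta>\<close>.\<close>
      by (intro exI[of _ "\<lambda>y. 0 < y \<and> y < \<delta>"]) blast
  qed blast
  finally show ?thesis .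
qed

text \<open>Turns the lower limit into an \<epsilon>-\<delta> condition; the denominator can be
  cleared because the filter only sees positive norms.\<close>

lemma mem_frechet_subdifferential_iff:
  "\<eta> \<in> frechet_subdifferential \<Omega> s r f u \<longleftrightarrow> \<eta> \<in> Lp r \<Omega> \<and>
    (\<forall>\<epsilon>>0. \<exists>\<delta>>0. \<forall>h\<in>Lp s \<Omega>. 0 < Lp_norm s \<Omega> h \<and> Lp_norm s \<Omega> h < \<delta> \<longrightarrow>
      - \<epsilon> * Lp_norm s \<Omega> h < f (\<lambda>x. u x + h x) - f u - (LINT x|lebesgue_on \<Omega>. \<eta> x * h x))"
proof -
  let ?Q = "\<lambda>h. (f (\<lambda>x. u x + h x) - f u - (LINT x|lebesgue_on \<Omega>. \<eta> x * h x)) / Lp_norm s \<Omega> h"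
  have "0 \<le> Liminf (Lp_at_zero s \<Omega>) (\<lambda>h. ereal (?Q h))
      \<longleftrightarrow> (\<forall>\<epsilon>>0. eventually (\<lambda>h. - \<epsilon> < ?Q h) (Lp_at_zero s \<Omega>))"
  proof (unfold le_Liminf_iff, intro iffI allI impI)
    fix \<epsilon> :: real
    assume *: "\<forall>y<0. eventually (\<lambda>h. y < ereal (?Q h)) (Lp_at_zero s \<Omega>)" and "\<epsilon> > 0"
    then show "eventually (\<lambda>h. - \<epsilon> < ?Q h) (Lp_at_zero s \<Omega>)"
      using *[rule_format, of "ereal (- \<epsilon>)"] by simp
  next
    fix y :: ereal
    assume *: "\<forall>\<epsilon>>0. eventually (\<lambda>h. - \<epsilon> < ?Q h) (Lp_at_zero s \<Omega>)" and "y < 0"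
    \<comment> \<open>The bound \<open>y\<close> may be minus infinity, so a real number between
      \<open>y\<close> and \<open>0\<close> supplies the \<epsilon>.\<close>
    then obtain z where z: "y < ereal z" "ereal z < 0" using ereal_dense2 by blast
    have "eventually (\<lambda>h. - (- z) < ?Q h) (Lp_at_zero s \<Omega>)"
      using *[rule_format, of "- z"] z(2) by simp
    then show "eventually (\<lambda>h. y < ereal (?Q h)) (Lp_at_zero s \<Omega>)"
    proof (rule eventually_mono)
      fix h assume "- (- z) < ?Q h"
      then have "ereal z < ereal (?Q h)" by simp
      with z(1) show "y < ereal (?Q h)" by (rule order.strict_trans)
    qed
  qed
  then show ?thesis
    unfolding frechet_subdifferential_def eventually_Lp_at_zero
    by (simp add: pos_less_divide_eq cong: conj_cong imp_cong)
qed

text \<open>Only points where exactly one of \<open>u\<close> and \<open>u + h\<close> vanishes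
  contribute, with sign \<open>+1\<close> if it is \<open>u\<close> and \<open>-1\<close> if it is
  \<open>u + h\<close>.\<close>

lemma q0_increment:
  assumes \<Omega>: "\<Omega> \<in> lmeasurable"
    and [measurable]: "u \<in> borel_measurable (lebesgue_on \<Omega>)" "h \<in> borel_measurable (lebesgue_on \<Omega>)"
  shows "q0 \<Omega> (\<lambda>x. u x + h x) - q0 \<Omega> u
    = measure (lebesgue_on \<Omega>) {x \<in> \<Omega>. u x = 0 \<and> h x \<noteq> 0}
      - measure (lebesgue_on \<Omega>) {x \<in> \<Omega>. u x \<noteq> 0 \<and> u x + h x = 0}"
proof -
  interpret finite_measure "lebesgue_on \<Omega>" using \<Omega> by (rule finite_measure_lebesgue_on)
  have sp: "{x \<in> \<Omega>. P x} = {x \<in> space (lebesgue_on \<Omega>). P x}" for P by simp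
  have [measurable]: "{x \<in> \<Omega>. u x = 0 \<and> h x \<noteq> 0} \<in> sets (lebesgue_on \<Omega>)"
    "{x \<in> \<Omega>. u x \<noteq> 0 \<and> u x + h x = 0} \<in> sets (lebesgue_on \<Omega>)"
    unfolding sp by measurable
  have abs0_int: "integrable (lebesgue_on \<Omega>) (\<lambda>x. abs0 (v x))"
    if [measurable]: "v \<in> borel_measurable (lebesgue_on \<Omega>)" for v
    unfolding abs0_def by (rule integrable_const_bound[where B = 1]) auto
  have "q0 \<Omega> (\<lambda>x. u x + h x) - q0 \<Omega> u = (LINT x|lebesgue_on \<Omega>. abs0 (u x + h x) - abs0 (u x))"
    unfolding q0_def
    by (intro Bochner_Integration.integral_diff[symmetric] abs0_int) measurable
  also have "\<dots> = (LINT x|lebesgue_on \<Omega>. indicator {x \<in> \<Omega>. u x = 0 \<and> h x \<noteq> 0} x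
      - indicator {x \<in> \<Omega>. u x \<noteq> 0 \<and> u x + h x = 0} x)"
    by (intro Bochner_Integration.integral_cong) (auto simp: abs0_def indicator_def)
  also have "\<dots> = measure (lebesgue_on \<Omega>) {x \<in> \<Omega>. u x = 0 \<and> h x \<noteq> 0}
      - measure (lebesgue_on \<Omega>) {x \<in> \<Omega>. u x \<noteq> 0 \<and> u x + h x = 0}"
    by (subst Bochner_Integration.integral_diff)
       (auto simp: integrable_real_indicator less_top[symmetric] Int_absorb2)
  finally show ?thesis .
qed

text \<open>Passes from sequences to a uniform \<epsilon>-\<delta> bound by contradiction: if no
  threshold works, choosing a violating set of measure below \<open>1 / (k + 1)\<close> for each
  \<open>k\<close> gives a sequence that contradicts slow decrease.\<close>

lemma slowly_decreasingD:
  assumes \<Omega>: "\<Omega> \<in> lmeasurable" and u: "u \<in> Lp s \<Omega>" "1 < s"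
    and sd: "slowly_decreasing s \<Omega> u" and "\<epsilon> > 0"
  obtains \<delta> where "\<delta> > 0"
    and "\<And>A. A \<in> sets (lebesgue_on \<Omega>) \<Longrightarrow> ae_subset \<Omega> A {x \<in> \<Omega>. u x \<noteq> 0}
      \<Longrightarrow> measure (lebesgue_on \<Omega>) A < \<delta> \<Longrightarrow> measure (lebesgue_on \<Omega>) A \<le> \<epsilon> * Lp_norm s A u"
proof (rule ccontr)
  assume none: "\<not> thesis"
  define P where "P k A \<longleftrightarrow> A \<in> sets (lebesgue_on \<Omega>) \<and> ae_subset \<Omega> A {x \<in> \<Omega>. u x \<noteq> 0}
      \<and> measure (lebesgue_on \<Omega>) A < inverse (real (Suc k))
      \<and> \<epsilon> * Lp_norm s A u < measure (lebesgue_on \<Omega>) A" for k A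
  have "\<exists>A. P k A" for k
  proof (rule ccontr)
    assume "\<nexists>A. P k A"
    then have thesis
      by (intro that[of "inverse (real (Suc k))"]) (auto simp: P_def not_less)
    with none show False by contradiction
  qed
  then obtain A where "\<And>k. P k (A k)" by metis
  then have A: "\<And>k. A k \<in> sets (lebesgue_on \<Omega>)"
      "\<And>k. ae_subset \<Omega> (A k) {x \<in> \<Omega>. u x \<noteq> 0}"
      "\<And>k. measure (lebesgue_on \<Omega>) (A k) < inverse (real (Suc k))"
      "\<And>k. \<epsilon> * Lp_norm s (A k) u < measure (lebesgue_on \<Omega>) (A k)"
    by (simp_all only: P_def)
  have eq: "measure (lebesgue_on \<Omega>) (A k) = measure lebesgue (A k)" for k
    using measure_lebesgue_on_eq \<Omega> A(1) by blast
  \<comment> \<open>Each violation is a strict inequality above a nonnegative number, so the chosen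
    sets are not null and form an admissible sequence.\<close>
  have pos: "0 < measure (lebesgue_on \<Omega>) (A k)" for k
    using A(4)[of k] mult_nonneg_nonneg[of \<epsilon> "Lp_norm s (A k) u"] \<open>\<epsilon> > 0\<close> Lp_norm_nonneg[of s "A k" u]
    by linarith
  have "(\<lambda>k. measure lebesgue (A k)) \<longlonglongrightarrow> 0"
  proof (rule tendsto_sandwich[OF _ _ tendsto_const LIMSEQ_inverse_real_of_nat])
    show "\<forall>\<^sub>F k in sequentially. measure lebesgue (A k) \<le> inverse (real (Suc k))"
      using A(3) by (intro always_eventually allI less_imp_le) (simp only: eq)
  qed simp
  then have "(\<lambda>k. measure lebesgue (A k) / Lp_norm s (A k) u) \<longlonglongrightarrow> 0"
    using sd A(1,2) pos unfolding slowly_decreasing_def eq by blast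
  then have "\<forall>\<^sub>F k in sequentially. measure lebesgue (A k) / Lp_norm s (A k) u < \<epsilon>"
    using \<open>\<epsilon> > 0\<close> by (rule order_tendstoD(2))
  then obtain k where k: "measure lebesgue (A k) / Lp_norm s (A k) u < \<epsilon>"
    by (auto simp: eventually_sequentially)
  \<comment> \<open>This excludes the default value \<open>0\<close> of division by zero, so the
    quotient bound can be multiplied out.\<close>
  have "0 < Lp_norm s (A k) u" using Lp_norm_pos[OF \<Omega> u A(1,2) pos] .
  with k A(4)[of k] show False by (simp add: eq divide_less_eq)
qed

section \<open>Sufficiency of slow decrease and of the support condition\<close>

lemma mem_frechet_subdifferential_q0I:
  assumes \<Omega>: "\<Omega> \<in> lmeasurable" and sr: "1 < s" "1 < r" "1 / s + 1 / r = 1"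
    and u: "u \<in> Lp s \<Omega>" and sd: "slowly_decreasing s \<Omega> u"
    and \<eta>: "\<eta> \<in> Lp r \<Omega>" and supp: "ae_subset \<Omega> {x \<in> \<Omega>. \<eta> x \<noteq> 0} {x \<in> \<Omega>. u x = 0}"
  shows "\<eta> \<in> frechet_subdifferential \<Omega> s r (q0 \<Omega>) u"
  unfolding mem_frechet_subdifferential_iff
proof (intro conjI allI impI \<eta>)
  interpret finite_measure "lebesgue_on \<Omega>" using \<Omega> by (rule finite_measure_lebesgue_on)
  have \<Omega>': "\<Omega> \<in> sets lebesgue" using \<Omega> by auto
  \<comment> \<open>One third of \<epsilon> goes to the loss on \<open>A\<close>, one third to the
    integral over \<open>B\<close>; the last third makes the final inequality strict.\<close>
  fix \<epsilon> :: real assume "\<epsilon> > 0"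
  then have "\<epsilon> / 3 > 0" by simp
  obtain \<delta>1 where \<delta>1: "\<delta>1 > 0"
    "\<And>A. A \<in> sets (lebesgue_on \<Omega>) \<Longrightarrow> ae_subset \<Omega> A {x \<in> \<Omega>. u x \<noteq> 0}
      \<Longrightarrow> measure (lebesgue_on \<Omega>) A < \<delta>1 \<Longrightarrow> measure (lebesgue_on \<Omega>) A \<le> \<epsilon> / 3 * Lp_norm s A u"
    using slowly_decreasingD[OF \<Omega> u sr(1) sd \<open>\<epsilon> / 3 > 0\<close>] by blast
  obtain c where c: "c > 0"
    "\<And>A. A \<in> sets (lebesgue_on \<Omega>) \<Longrightarrow> ae_subset \<Omega> A {x \<in> \<Omega>. u x \<noteq> 0}
      \<Longrightarrow> \<delta>1 \<le> measure (lebesgue_on \<Omega>) A \<Longrightarrow> c \<le> Lp_norm s A u"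
    using Lp_norm_bounded_below_on_large_sets[OF \<Omega> u sr(1) \<delta>1(1)] by blast
  obtain \<delta>2 where \<delta>2: "\<delta>2 > 0"
    "\<And>A. A \<in> sets (lebesgue_on \<Omega>) \<Longrightarrow> measure (lebesgue_on \<Omega>) A < \<delta>2 \<Longrightarrow> Lp_norm r A \<eta> < \<epsilon> / 3"
    using Lp_norm_small_on_small_sets[OF \<Omega> \<eta> sr(2) \<open>\<epsilon> / 3 > 0\<close>] by blast
  \<comment> \<open>The summand \<open>1\<close> keeps \<open>\<delta>2 / K\<close> meaningful when
    \<eta> vanishes almost everywhere.\<close>
  define K where "K = Lp_norm r \<Omega> \<eta> + 1"
  have K: "K > 0" using Lp_norm_nonneg[of r \<Omega> \<eta>] by (simp add: K_def)
  show "\<exists>\<delta>>0. \<forall>h\<in>Lp s \<Omega>. 0 < Lp_norm s \<Omega> h \<and> Lp_norm s \<Omega> h < \<delta> \<longrightarrow>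
      - \<epsilon> * Lp_norm s \<Omega> h < q0 \<Omega> (\<lambda>x. u x + h x) - q0 \<Omega> u - (LINT x|lebesgue_on \<Omega>. \<eta> x * h x)"
  \<comment> \<open>Norms below \<open>c\<close> force \<open>A\<close> to have measure below
    \<open>\<delta>1\<close>; norms below \<open>\<delta>2 / K\<close> keep the Hoelder bound below
    \<open>\<delta>2\<close>, hence below the measure of \<open>B\<close> when \<open>B\<close> is
    large.\<close>
  proof (intro exI[of _ "min c (\<delta>2 / K)"] conjI ballI impI)
    show "0 < min c (\<delta>2 / K)" using c(1) \<delta>2(1) K by simp
    fix h assume h: "h \<in> Lp s \<Omega>" and "0 < Lp_norm s \<Omega> h \<and> Lp_norm s \<Omega> h < min c (\<delta>2 / K)"
    then have n: "0 < Lp_norm s \<Omega> h" "Lp_norm s \<Omega> h < c" "Lp_norm s \<Omega> h < \<delta>2 / K" by auto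
    have [measurable]: "u \<in> borel_measurable (lebesgue_on \<Omega>)" "h \<in> borel_measurable (lebesgue_on \<Omega>)"
      "\<eta> \<in> borel_measurable (lebesgue_on \<Omega>)"
      using u h \<eta> by (auto simp: Lp_def)
    define A where "A = {x \<in> \<Omega>. u x \<noteq> 0 \<and> u x + h x = 0}"
    define B where "B = {x \<in> \<Omega>. u x = 0 \<and> h x \<noteq> 0}"
    have sp: "{x \<in> \<Omega>. P x} = {x \<in> space (lebesgue_on \<Omega>). P x}" for P by simp
    have meas[measurable]: "A \<in> sets (lebesgue_on \<Omega>)" "B \<in> sets (lebesgue_on \<Omega>)"
      unfolding A_def B_def sp by measurable
    have Asub: "ae_subset \<Omega> A {x \<in> \<Omega>. u x \<noteq> 0}" by (auto simp: ae_subset_def A_def)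
    have "Lp_norm s A u = Lp_norm s A h" by (rule Lp_norm_cong) (auto simp: A_def)
    also have "\<dots> \<le> Lp_norm s \<Omega> h" by (rule Lp_norm_subset_mono[OF \<Omega>' meas(1) h sr(1)])
    finally have uh: "Lp_norm s A u \<le> Lp_norm s \<Omega> h" .
    have "measure (lebesgue_on \<Omega>) A < \<delta>1"
      using c(2)[OF meas(1) Asub] uh n(2) by force
    then have "measure (lebesgue_on \<Omega>) A \<le> \<epsilon> / 3 * Lp_norm s A u" by (intro \<delta>1(2) meas Asub)
    also have "\<dots> \<le> \<epsilon> / 3 * Lp_norm s \<Omega> h" using uh \<open>\<epsilon> > 0\<close> by (intro mult_left_mono) auto
    finally have mA: "measure (lebesgue_on \<Omega>) A \<le> \<epsilon> / 3 * Lp_norm s \<Omega> h" .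
    \<comment> \<open>Off \<open>B\<close> either \<open>h\<close> is zero or \<open>u\<close> is
      nonzero, and in the latter case \<eta> is zero almost everywhere by the support
      condition.\<close>
    have "(LINT x|lebesgue_on \<Omega>. \<eta> x * h x) = (LINT x|lebesgue_on \<Omega>. indicator B x * (\<eta> x * h x))"
    proof (rule integral_cong_AE)
      show "AE x in lebesgue_on \<Omega>. \<eta> x * h x = indicator B x * (\<eta> x * h x)"
        using supp AE_space unfolding ae_subset_def
        by eventually_elim (auto simp: B_def indicator_def)
    qed measurable
    also have "\<dots> \<le> Lp_norm r B \<eta> * Lp_norm s B h"
      using Holder_Lp[OF \<Omega>' meas(2) sr \<eta> h] by linarith
    also have "\<dots> \<le> Lp_norm r B \<eta> * Lp_norm s \<Omega> h"
      by (intro mult_left_mono Lp_norm_subset_mono \<Omega>' meas h sr Lp_norm_nonneg)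
    also have "\<dots> \<le> \<epsilon> / 3 * Lp_norm s \<Omega> h + measure (lebesgue_on \<Omega>) B"
    proof (cases "measure (lebesgue_on \<Omega>) B < \<delta>2")
      case True
      then have "Lp_norm r B \<eta> * Lp_norm s \<Omega> h \<le> \<epsilon> / 3 * Lp_norm s \<Omega> h"
        using \<delta>2(2)[OF meas(2)] n(1) by (intro mult_right_mono) auto
      then show ?thesis using measure_nonneg[of "lebesgue_on \<Omega>" B] by linarith
    next
      case False
      have "Lp_norm r B \<eta> \<le> K"
        using Lp_norm_subset_mono[OF \<Omega>' meas(2) \<eta> sr(2)] by (simp add: K_def)
      then have "Lp_norm r B \<eta> * Lp_norm s \<Omega> h \<le> K * Lp_norm s \<Omega> h"
        using n(1) by (intro mult_right_mono) auto
      also have "\<dots> \<le> \<delta>2" using n(3) K by (simp add: field_simps)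
      finally show ?thesis using False n(1) mult_pos_pos[OF \<open>\<epsilon> / 3 > 0\<close> n(1)] by linarith
    qed
    finally have "(LINT x|lebesgue_on \<Omega>. \<eta> x * h x)
      \<le> \<epsilon> / 3 * Lp_norm s \<Omega> h + measure (lebesgue_on \<Omega>) B" .
    moreover have "q0 \<Omega> (\<lambda>x. u x + h x) - q0 \<Omega> u
        = measure (lebesgue_on \<Omega>) B - measure (lebesgue_on \<Omega>) A"
      unfolding A_def B_def by (rule q0_increment) (use \<Omega> in auto)
    ultimately show "- \<epsilon> * Lp_norm s \<Omega> h
        < q0 \<Omega> (\<lambda>x. u x + h x) - q0 \<Omega> u - (LINT x|lebesgue_on \<Omega>. \<eta> x * h x)"
      using mA mult_pos_pos[OF \<open>\<epsilon> > 0\<close> n(1)] by (simp; linarith)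
  qed
qed

section \<open>Necessity: consequences of having a subgradient\<close>

text \<open>Erasing \<open>u\<close> on \<open>A k\<close> lowers \<open>q0\<close> by exactly the
  measure of \<open>A k\<close>, at a step of norm \<open>N k\<close>. The subgradient inequality
  limits this drop to \<open>\<epsilon> / 2 * N k\<close> plus a Hoelder term, itself at most
  \<open>\<epsilon> / 2 * N k\<close> for large \<open>k\<close>.\<close>

lemma frechet_subdifferential_q0_slowly_decreasing:
  assumes \<Omega>: "\<Omega> \<in> lmeasurable" and sr: "1 < s" "1 < r" "1 / s + 1 / r = 1"
    and u: "u \<in> Lp s \<Omega>" and sub: "\<eta> \<in> frechet_subdifferential \<Omega> s r (q0 \<Omega>) u"
  shows "slowly_decreasing s \<Omega> u"
  unfolding slowly_decreasing_def
proof (intro allI impI)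
  have \<Omega>': "\<Omega> \<in> sets lebesgue" using \<Omega> by auto
  have \<eta>: "\<eta> \<in> Lp r \<Omega>" using sub by (simp add: mem_frechet_subdifferential_iff)
  have um[measurable]: "u \<in> borel_measurable (lebesgue_on \<Omega>)" using u by (simp add: Lp_def)
  fix A :: "nat \<Rightarrow> (real ^ 'a) set"
  assume "(\<forall>k. A k \<in> sets (lebesgue_on \<Omega>) \<and> ae_subset \<Omega> (A k) {x \<in> \<Omega>. u x \<noteq> 0}
      \<and> measure lebesgue (A k) > 0) \<and> (\<lambda>k. measure lebesgue (A k)) \<longlonglongrightarrow> 0"
  then have meas[measurable]: "\<And>k. A k \<in> sets (lebesgue_on \<Omega>)"
    and Asub: "\<And>k. ae_subset \<Omega> (A k) {x \<in> \<Omega>. u x \<noteq> 0}"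
    and pos': "\<And>k. measure lebesgue (A k) > 0" and lim': "(\<lambda>k. measure lebesgue (A k)) \<longlonglongrightarrow> 0"
    by auto
  have eq: "measure lebesgue (A k) = measure (lebesgue_on \<Omega>) (A k)" for k
    using measure_lebesgue_on_eq \<Omega>' meas by metis
  note pos = pos'[unfolded eq] and lim = lim'[unfolded eq]
  define N where "N k = Lp_norm s (A k) u" for k
  have Npos: "0 < N k" for k unfolding N_def by (rule Lp_norm_pos[OF \<Omega> u sr(1) meas Asub pos])
  \<comment> \<open>Serves twice: for \<open>u\<close>, to bring the step within range of the
    subgradient inequality, and for \<eta>, to make the Hoelder term small.\<close>
  have ev_small: "\<forall>\<^sub>F k in sequentially. Lp_norm p (A k) f < \<epsilon>"
    if f: "f \<in> Lp p \<Omega>" and p: "1 < p" and \<epsilon>: "\<epsilon> > 0" for f p \<epsilon>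
  proof -
    obtain \<delta> where \<delta>: "\<delta> > 0"
      "\<And>A. A \<in> sets (lebesgue_on \<Omega>) \<Longrightarrow> measure (lebesgue_on \<Omega>) A < \<delta> \<Longrightarrow> Lp_norm p A f < \<epsilon>"
      using Lp_norm_small_on_small_sets[OF \<Omega> f p \<epsilon>] by blast
    show ?thesis
      using order_tendstoD(2)[OF lim \<delta>(1)] by eventually_elim (intro \<delta>(2) meas)
  qed
  have "(\<lambda>k. measure (lebesgue_on \<Omega>) (A k) / N k) \<longlonglongrightarrow> 0"
  proof (rule order_tendstoI)
    fix a :: real assume "a < 0"
    moreover have "0 \<le> measure (lebesgue_on \<Omega>) (A k) / N k" for k
      using Npos[of k] by simp
    ultimately show "\<forall>\<^sub>F k in sequentially. a < measure (lebesgue_on \<Omega>) (A k) / N k"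
      by (intro always_eventually allI) (rule order.strict_trans2)
  next
    fix \<epsilon> :: real assume "0 < \<epsilon>"
    then have "\<epsilon> / 2 > 0" by simp
    then obtain \<delta> where \<delta>: "\<delta> > 0"
      "\<And>h. h \<in> Lp s \<Omega> \<Longrightarrow> 0 < Lp_norm s \<Omega> h \<Longrightarrow> Lp_norm s \<Omega> h < \<delta> \<Longrightarrow>
        - (\<epsilon> / 2) * Lp_norm s \<Omega> h
          < q0 \<Omega> (\<lambda>x. u x + h x) - q0 \<Omega> u - (LINT x|lebesgue_on \<Omega>. \<eta> x * h x)"
      using sub unfolding mem_frechet_subdifferential_iff by blast
    show "\<forall>\<^sub>F k in sequentially. measure (lebesgue_on \<Omega>) (A k) / N k < \<epsilon>"
      using ev_small[OF u sr(1) \<delta>(1)] ev_small[OF \<eta> sr(2) \<open>\<epsilon> / 2 > 0\<close>]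
    proof eventually_elim
      fix k assume small: "Lp_norm s (A k) u < \<delta>" "Lp_norm r (A k) \<eta> < \<epsilon> / 2"
      define h where "h x = indicator (A k) x * - u x" for x
      have h: "h \<in> Lp s \<Omega>" unfolding h_def by (intro Lp_indicator meas Lp_uminus u)
      have hm[measurable]: "h \<in> borel_measurable (lebesgue_on \<Omega>)" using h by (simp add: Lp_def)
      have nh: "Lp_norm s \<Omega> h = N k"
        unfolding h_def Lp_norm_indicator[OF \<Omega>' meas] N_def by (rule Lp_norm_cong) simp
      have B: "{x \<in> \<Omega>. u x = 0 \<and> h x \<noteq> 0} = {}" by (auto simp: h_def)
      \<comment> \<open>The two sets may differ by a null set, since \<open>A k\<close> lies in the
        support of \<open>u\<close> only almost everywhere.\<close>
      have "measure (lebesgue_on \<Omega>) {x \<in> \<Omega>. u x \<noteq> 0 \<and> u x + h x = 0}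
          = measure (lebesgue_on \<Omega>) (A k)"
      proof (rule measure_eq_AE)
        show "AE x in lebesgue_on \<Omega>. (x \<in> {x \<in> \<Omega>. u x \<noteq> 0 \<and> u x + h x = 0}) = (x \<in> A k)"
          using Asub[of k] AE_space unfolding ae_subset_def
          by eventually_elim (auto simp: h_def indicator_def)
        have "{x \<in> space (lebesgue_on \<Omega>). u x \<noteq> 0 \<and> u x + h x = 0} \<in> sets (lebesgue_on \<Omega>)"
          by measurable
        then show "{x \<in> \<Omega>. u x \<noteq> 0 \<and> u x + h x = 0} \<in> sets (lebesgue_on \<Omega>)" by simp
      qed (rule meas)
      then have q: "q0 \<Omega> (\<lambda>x. u x + h x) - q0 \<Omega> u = - measure (lebesgue_on \<Omega>) (A k)"
        unfolding q0_increment[OF \<Omega> um hm] B by simp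
      have "- (LINT x|lebesgue_on \<Omega>. \<eta> x * h x)
          = (LINT x|lebesgue_on \<Omega>. indicator (A k) x * (\<eta> x * u x))"
        unfolding h_def Bochner_Integration.integral_minus[symmetric]
        by (intro Bochner_Integration.integral_cong) auto
      also have "\<dots> \<le> Lp_norm r (A k) \<eta> * N k"
        using Holder_Lp[OF \<Omega>' meas sr \<eta> u, of k] unfolding N_def by linarith
      also have "\<dots> \<le> \<epsilon> / 2 * N k"
        using small(2) Npos[of k] by (intro mult_right_mono) auto
      finally have "- (LINT x|lebesgue_on \<Omega>. \<eta> x * h x) \<le> \<epsilon> / 2 * N k" .
      moreover have "- (\<epsilon> / 2) * N k
          < - measure (lebesgue_on \<Omega>) (A k) - (LINT x|lebesgue_on \<Omega>. \<eta> x * h x)"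
        using \<delta>(2)[OF h] small(1) Npos[of k] unfolding q nh by (simp add: N_def)
      ultimately have "measure (lebesgue_on \<Omega>) (A k) < \<epsilon> * N k" by (simp; linarith)
      then show "measure (lebesgue_on \<Omega>) (A k) / N k < \<epsilon>"
        using Npos[of k] by (simp add: divide_less_eq)
    qed
  qed
  then show "(\<lambda>k. measure lebesgue (A k) / Lp_norm s (A k) u) \<longlonglongrightarrow> 0"
    unfolding eq N_def .
qed

text \<open>Where \<open>u\<close> is bounded away from zero, small bounded perturbations leave
  \<open>q0\<close> unchanged. The difference quotient along \<open>h\<close> is then
  \<open>- I / d\<close> whatever the size of \<open>t\<close>, which violates the subgradient
  inequality for the tolerance \<open>I / d\<close>.\<close>

lemma frechet_subdifferential_q0_support:
  assumes \<Omega>: "\<Omega> \<in> lmeasurable" and sr: "1 < s" "1 < r" "1 / s + 1 / r = 1"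
    and u: "u \<in> Lp s \<Omega>" and sub: "\<eta> \<in> frechet_subdifferential \<Omega> s r (q0 \<Omega>) u"
  shows "ae_subset \<Omega> {x \<in> \<Omega>. \<eta> x \<noteq> 0} {x \<in> \<Omega>. u x = 0}"
proof -
  interpret finite_measure "lebesgue_on \<Omega>" using \<Omega> by (rule finite_measure_lebesgue_on)
  have \<Omega>': "\<Omega> \<in> sets lebesgue" using \<Omega> by auto
  have \<eta>: "\<eta> \<in> Lp r \<Omega>" using sub by (simp add: mem_frechet_subdifferential_iff)
  have um[measurable]: "u \<in> borel_measurable (lebesgue_on \<Omega>)"
    and [measurable]: "\<eta> \<in> borel_measurable (lebesgue_on \<Omega>)"
    using u \<eta> by (auto simp: Lp_def)
  have const: "(\<lambda>x. c) \<in> Lp p \<Omega>" for c p by (simp add: Lp_def)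
  \<comment> \<open>Hoelder's inequality against the constant \<open>1\<close>, which lies in every
    \<open>Lp\<close> because the measure is finite.\<close>
  have \<eta>int: "integrable (lebesgue_on \<Omega>) (\<lambda>x. \<bar>\<eta> x\<bar>)"
    using Holder_integrable[OF sr(2,1) _ _ _ _ , of \<eta> "lebesgue_on \<Omega>" "\<lambda>_. 1"] sr(3) \<eta>
    by (auto simp: Lp_def add.commute)
  have null: "AE x in lebesgue_on \<Omega>. \<not> (\<eta> x \<noteq> 0 \<and> \<gamma> < \<bar>u x\<bar>)" if "\<gamma> > 0" for \<gamma>
  proof -
    define D where "D = {x \<in> space (lebesgue_on \<Omega>). \<eta> x \<noteq> 0 \<and> \<gamma> < \<bar>u x\<bar>}"
    have meas[measurable]: "D \<in> sets (lebesgue_on \<Omega>)" unfolding D_def by measurable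
    define I where "I = (LINT x|lebesgue_on \<Omega>. indicator D x * \<bar>\<eta> x\<bar>)"
    define d where "d = Lp_norm s D (\<lambda>_. 1)"
    have iD: "integrable (lebesgue_on \<Omega>) (\<lambda>x. indicator D x * \<bar>\<eta> x\<bar>)"
      using integrable_mult_indicator[OF meas \<eta>int] by simp
    have "measure (lebesgue_on \<Omega>) D = 0"
    proof (rule ccontr)
      assume "measure (lebesgue_on \<Omega>) D \<noteq> 0"
      then have Dpos: "measure (lebesgue_on \<Omega>) D > 0"
        using zero_less_measure_iff by blast
      have dpos: "d > 0"
        unfolding d_def by (rule Lp_norm_pos[OF \<Omega> const sr(1) meas _ Dpos]) (auto simp: ae_subset_def D_def)
      have "I \<noteq> 0"
      proof
        assume "I = 0"
        then have "AE x in lebesgue_on \<Omega>. indicator D x * \<bar>\<eta> x\<bar> = 0"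
          unfolding I_def using iD by (subst (asm) integral_nonneg_eq_0_iff_AE) auto
        then have "AE x in lebesgue_on \<Omega>. x \<notin> D"
          by eventually_elim (auto simp: D_def indicator_def split: if_splits)
        then have "D \<in> null_sets (lebesgue_on \<Omega>)"
          using AE_iff_null_sets[OF meas] by simp
        then show False using Dpos by (simp add: measure_eq_0_null_sets)
      qed
      moreover have "I \<ge> 0" unfolding I_def by (intro Bochner_Integration.integral_nonneg) auto
      ultimately have Ipos: "I > 0" by simp
      then have "I / d > 0" using dpos by simp
      then obtain \<delta> where \<delta>: "\<delta> > 0"
        "\<And>h. h \<in> Lp s \<Omega> \<Longrightarrow> 0 < Lp_norm s \<Omega> h \<Longrightarrow> Lp_norm s \<Omega> h < \<delta> \<Longrightarrow>
          - (I / d) * Lp_norm s \<Omega> h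
            < q0 \<Omega> (\<lambda>x. u x + h x) - q0 \<Omega> u - (LINT x|lebesgue_on \<Omega>. \<eta> x * h x)"
        using sub unfolding mem_frechet_subdifferential_iff by blast
      \<comment> \<open>Being below \<gamma>, the step cannot cancel \<open>u\<close> on
        \<open>D\<close>; being below \<open>\<delta> / d\<close>, its norm \<open>t * d\<close> is
        within range. Halving makes both bounds strict.\<close>
      define t where "t = min \<gamma> (\<delta> / d) / 2"
      have t: "0 < t" "t < \<gamma>" "t * d < \<delta>"
        using \<open>\<gamma> > 0\<close> \<delta>(1) dpos by (auto simp: t_def min_def field_simps)
      define h where "h x = indicator D x * (t * sgn (\<eta> x))" for x
      have hm[measurable]: "h \<in> borel_measurable (lebesgue_on \<Omega>)" unfolding h_def by measurable
      have hb: "\<bar>h x\<bar> powr s = t powr s * indicator D x" for x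
        using t(1) by (auto simp: h_def D_def indicator_def abs_mult abs_sgn_eq)
      have h: "h \<in> Lp s \<Omega>"
        by (simp add: Lp_def hb integrable_real_indicator less_top[symmetric])
      have nh: "Lp_norm s \<Omega> h = t * d"
      proof -
        have "(LINT x|lebesgue_on \<Omega>. \<bar>h x\<bar> powr s) = t powr s * measure (lebesgue_on \<Omega>) D"
          using sets.sets_into_space[OF meas] by (simp add: hb Int_absorb2)
        then have "Lp_norm s \<Omega> h = t * measure (lebesgue_on \<Omega>) D powr (1 / s)"
          using t(1) sr(1) by (simp add: Lp_norm_def powr_mult powr_powr)
        then show ?thesis
          using sets.sets_into_space[OF meas]
          by (simp add: d_def Lp_norm_subset_eq[OF \<Omega>' meas] Int_absorb2)
      qed
      have B: "{x \<in> \<Omega>. u x = 0 \<and> h x \<noteq> 0} = {}"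
        using \<open>\<gamma> > 0\<close> by (auto simp: h_def D_def)
      have A: "{x \<in> \<Omega>. u x \<noteq> 0 \<and> u x + h x = 0} = {}"
        using t(1,2) by (auto simp: h_def D_def indicator_def sgn_if split: if_splits)
      have q: "q0 \<Omega> (\<lambda>x. u x + h x) - q0 \<Omega> u = 0"
        unfolding q0_increment[OF \<Omega> um hm] A B by simp
      have "(LINT x|lebesgue_on \<Omega>. \<eta> x * h x)
          = (LINT x|lebesgue_on \<Omega>. t * (indicator D x * \<bar>\<eta> x\<bar>))"
        by (intro Bochner_Integration.integral_cong) (auto simp: h_def abs_sgn)
      also have "\<dots> = t * I" by (simp add: I_def)
      \<comment> \<open>Both sides equal \<open>- t * I\<close>, so the strict inequality is
        absurd.\<close>
      finally have "- (I / d) * (t * d) < 0 - t * I"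
        using \<delta>(2)[OF h] t dpos unfolding nh q by simp
      then show False using dpos by simp
    qed
    then have "D \<in> null_sets (lebesgue_on \<Omega>)"
      by (intro null_setsI) (auto simp: emeasure_eq_measure)
    from AE_not_in[OF this] AE_space show ?thesis
      by eventually_elim (simp add: D_def)
  qed
  \<comment> \<open>Countably many levels exhaust the set where \<open>u\<close> is nonzero, so the
    exceptional null sets can be combined.\<close>
  have "AE x in lebesgue_on \<Omega>. \<forall>n. \<not> (\<eta> x \<noteq> 0 \<and> inverse (real (Suc n)) < \<bar>u x\<bar>)"
    unfolding AE_all_countable by (intro allI null) simp
  then show ?thesis
    unfolding ae_subset_def
  proof eventually_elim
    fix x assume x: "\<forall>n. \<not> (\<eta> x \<noteq> 0 \<and> inverse (real (Suc n)) < \<bar>u x\<bar>)"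
    have "u x = 0" if "\<eta> x \<noteq> 0"
    proof (rule ccontr)
      assume "u x \<noteq> 0"
      then obtain n where "inverse (real (Suc n)) < \<bar>u x\<bar>" using reals_Archimedean[of "\<bar>u x\<bar>"] by auto
      with x that show False by blast
    qed
    then show "x \<in> {x \<in> \<Omega>. \<eta> x \<noteq> 0} \<longrightarrow> x \<in> {x \<in> \<Omega>. u x = 0}" by auto
  qed
qed

theorem theorem3p5:
  fixes \<Omega> :: "(real ^ 'd) set" and s r :: real and u :: "real ^ 'd \<Rightarrow> real"
  assumes "\<Omega> \<in> sets lebesgue"
    and "0 < emeasure lebesgue \<Omega>" and "emeasure lebesgue \<Omega> < \<infinity>"
    and "1 < s" and "1 < r" and "1 / s + 1 / r = 1"
    and "u \<in> Lp s \<Omega>"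
  shows "frechet_subdifferential \<Omega> s r (q0 \<Omega>) u =
           (if slowly_decreasing s \<Omega> u
            then {\<eta> \<in> Lp r \<Omega>. ae_subset \<Omega> {x \<in> \<Omega>. \<eta> x \<noteq> 0} {x \<in> \<Omega>. u x = 0}}
            else {})"
proof -
  have \<Omega>: "\<Omega> \<in> lmeasurable" using assms(1,3) by (auto intro: fmeasurableI)
  note hyps = \<Omega> assms(4-7)
  have "\<eta> \<in> Lp r \<Omega>" if "\<eta> \<in> frechet_subdifferential \<Omega> s r (q0 \<Omega>) u" for \<eta>
    using that by (simp add: mem_frechet_subdifferential_iff)
  \<comment> \<open>In the second case the subdifferential is empty because a single subgradient
    would already force slow decrease.\<close>
  then show ?thesis
    using mem_frechet_subdifferential_q0I[OF hyps] frechet_subdifferential_q0_support[OF hyps]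
      frechet_subdifferential_q0_slowly_decreasing[OF hyps]
    by auto
qed

end
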